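(* Let $\mathcal{A}$ be a real line arrangement in $\mathbb{R}^2$. For each $d\in\mathbb{N}$, $\mathcal{F}_d\mathcal{D}(\mathcal{A})$ is a linear subspace of the space of coefficients $\mathcal{C}(d)$.
   Context: A real line arrangement is a finite nonempty set $\mathcal{A}$ of distinct (affine) lines in $\mathbb{R}^2$. For $L\in\mathcal{A}$ let $\alpha_L\in\mathbb{R}[x,y]$ be a polynomial of degree one with $L=\{\alpha_L=0\}$, and put $\mathcal{Q}_{\mathcal{A}}=\prod_{L\in\mathcal{A}}\alpha_L$. The module of $\mathcal{A}$-derivations is $\mathcal{D}(\mathcal{A})=\{\chi\in\mathrm{Der}_{\mathbb{R}}(\mathbb{R}[x,y]) \mid \chi\mathcal{Q}_{\mathcal{A}}\in (\mathcal{Q}_{\mathcal{A}})\}$, where derivations are written $\chi=P\partial_x+Q\partial_y$ with $P,Q\in\mathbb{R}[x,y]$ and are identified with polynomial vector fields on $\mathbb{R}^2$. For $d\in\mathbb{N}$, $\mathcal{F}_d\mathcal{D}(\mathcal{A})$ is the set of $P\partial_x+Q\partial_y\in\mathcal{D}(\mathcal{A})$ with $\deg P\le d$ and $\deg Q\le d$. The space of coefficients $\mathcal{C}(d)$ is the real vector space of all pairs of families of coefficients $\big((a_{i,j})_{i+j\le d},(b_{i,j})_{i+j\le d}\big)$ of pairs of polynomials $P=\sum_{i+j\le d}a_{i,j}x^iy^j$, $Q=\sum_{i+j\le d}b_{i,j}x^iy^j$ of degree at most $d$; thus $\mathcal{C}(d)\simeq\mathbb{R}^{(d+1)(d+2)}$.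 A vector field $P\partial_x+Q\partial_y$ with $\deg P,\deg Q\le d$ is identified with the element of $\mathcal{C}(d)$ given by its coefficients. *)

theory Defs
  imports "HOL-Analysis.Analysis" "HOL-Analysis.Finite_Function_Topology"
    "HOL-Computational_Algebra.Polynomial"
begin

text \<open>
  The ring of real polynomials in \<open>x\<close> and \<open>y\<close> is \<open>\<real>[x][y]\<close>: the outer variable is \<open>y\<close>, and the
  coefficient of \<open>x\<^sup>i y\<^sup>j\<close> in \<open>p\<close> is \<open>coeff (coeff p j) i\<close>.
\<close>

type_synonym bipoly = "real poly poly"

definition varX :: bipoly where "varX = [:[:0, 1:]:]"

definition varY :: bipoly where "varY = [:0, 1:]"

definition scale_bipoly :: "real \<Rightarrow> bipoly \<Rightarrow> bipoly" where
  "scale_bipoly c p = smult [:c:] p"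

definition eval_bipoly :: "bipoly \<Rightarrow> real \<times> real \<Rightarrow> real" where
  "eval_bipoly p = (\<lambda>(x, y). poly (poly p [:y:]) x)"

text \<open>As for the univariate \<open>degree\<close>, the zero polynomial gets total degree \<open>0\<close>.\<close>

definition total_degree :: "bipoly \<Rightarrow> nat" where
  "total_degree p = (LEAST n. \<forall>i j. n < i + j \<longrightarrow> coeff (coeff p j) i = 0)"

definition partial_x :: "bipoly \<Rightarrow> bipoly" where "partial_x p = map_poly pderiv p"

definition partial_y :: "bipoly \<Rightarrow> bipoly" where "partial_y p = pderiv p"


definition is_derivation :: "(bipoly \<Rightarrow> bipoly) \<Rightarrow> bool" where
  "is_derivation \<delta> \<longleftrightarrow> module_hom scale_bipoly scale_bipoly \<delta> \<and>
     (\<forall>f g. \<delta> (f * g) = \<delta> f * g + f * \<delta> g)"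

definition vector_field :: "bipoly \<Rightarrow> bipoly \<Rightarrow> bipoly \<Rightarrow> bipoly" where
  "vector_field P Q = (\<lambda>f. P * partial_x f + Q * partial_y f)"


definition line_arrangement :: "(real \<times> real) set set \<Rightarrow> bool" where
  "line_arrangement \<A> \<longleftrightarrow> finite \<A> \<and> \<A> \<noteq> {} \<and> (\<forall>L\<in>\<A>. affine L \<and> aff_dim L = 1)"

definition defining_polys ::
    "(real \<times> real) set set \<Rightarrow> ((real \<times> real) set \<Rightarrow> bipoly) \<Rightarrow> bool" where
  "defining_polys \<A> \<alpha> \<longleftrightarrow>
     (\<forall>L\<in>\<A>. total_degree (\<alpha> L) = 1 \<and> L = {p. eval_bipoly (\<alpha> L) p = 0})"

definition arrangement_poly ::
    "((real \<times> real) set \<Rightarrow> bipoly) \<Rightarrow> (real \<times> real) set set \<Rightarrow> bipoly" where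
  "arrangement_poly \<alpha> \<A> = (\<Prod>L\<in>\<A>. \<alpha> L)"

definition arr_derivations ::
    "((real \<times> real) set \<Rightarrow> bipoly) \<Rightarrow> (real \<times> real) set set \<Rightarrow> (bipoly \<Rightarrow> bipoly) set" where
  "arr_derivations \<alpha> \<A> =
     {\<delta>. is_derivation \<delta> \<and> arrangement_poly \<alpha> \<A> dvd \<delta> (arrangement_poly \<alpha> \<A>)}"

definition filtered_derivations ::
    "((real \<times> real) set \<Rightarrow> bipoly) \<Rightarrow> (real \<times> real) set set \<Rightarrow> nat \<Rightarrow> (bipoly \<Rightarrow> bipoly) set" where
  "filtered_derivations \<alpha> \<A> d =
     {vector_field P Q |P Q. vector_field P Q \<in> arr_derivations \<alpha> \<A> \<and>
        total_degree P \<le> d \<and> total_degree Q \<le> d}"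


text \<open>
  A family \<open>(a\<^sub>i\<^sub>j)\<close> with \<open>i + j \<le> d\<close> is a finitely supported function of \<open>(i, j)\<close> that vanishes
  for \<open>i + j > d\<close>; this embeds all the spaces of coefficients into one real vector space.
\<close>

type_synonym coeff_pair = "((nat \<times> nat) \<Rightarrow>\<^sub>0 real) \<times> ((nat \<times> nat) \<Rightarrow>\<^sub>0 real)"

definition coeff_space :: "nat \<Rightarrow> coeff_pair set" where
  "coeff_space d = {(a, b). Poly_Mapping.keys a \<subseteq> {(i, j). i + j \<le> d} \<and>
                            Poly_Mapping.keys b \<subseteq> {(i, j). i + j \<le> d}}"

definition coeff_family :: "bipoly \<Rightarrow> (nat \<times> nat) \<Rightarrow>\<^sub>0 real" where
  "coeff_family p = Abs_poly_mapping (\<lambda>(i, j). coeff (coeff p j) i)"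

text \<open>
  The identification of a vector field \<open>\<delta> = P \<partial>\<^sub>x + Q \<partial>\<^sub>y\<close> with its coefficients. The components are
  recovered as \<open>P = \<delta> x\<close> and \<open>Q = \<delta> y\<close>; see \<open>vf_coeffs_vector_field\<close> below.
\<close>

definition vf_coeffs :: "(bipoly \<Rightarrow> bipoly) \<Rightarrow> coeff_pair" where
  "vf_coeffs \<delta> = (coeff_family (\<delta> varX), coeff_family (\<delta> varY))"



lemma finite_bipoly_support: "finite {(i, j). coeff (coeff (p::bipoly) j) i \<noteq> 0}"
proof (rule finite_subset)
  show "{(i, j). coeff (coeff p j) i \<noteq> 0} \<subseteq> (\<Union>j\<le>degree p. (\<lambda>i. (i, j)) ` {..degree (coeff p j)})"
  proof clarify
    fix i j assume "coeff (coeff p j) i \<noteq> 0"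
    moreover from this have "coeff p j \<noteq> 0" by auto
    ultimately show "(i, j) \<in> (\<Union>j\<le>degree p. (\<lambda>i. (i, j)) ` {..degree (coeff p j)})"
      by (intro UN_I[of j] image_eqI[of _ _ i]) (simp_all add: le_degree)
  qed
qed auto

lemma lookup_coeff_family:
  "Poly_Mapping.lookup (coeff_family p) (i, j) = coeff (coeff p j) i"
  unfolding coeff_family_def
  using finite_bipoly_support[of p] by (subst lookup_Abs_poly_mapping) (auto simp: case_prod_unfold)

lemma coeff_family_inject: "coeff_family p = coeff_family q \<longleftrightarrow> p = q"
  by (metis lookup_coeff_family poly_eq_iff)

lemma total_degree_le_iff:
  "total_degree p \<le> d \<longleftrightarrow> (\<forall>i j. d < i + j \<longrightarrow> coeff (coeff p j) i = 0)"
proof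
  define M where "M = Max (insert 0 ((\<lambda>(i, j). i + j) ` {(i, j). coeff (coeff p j) i \<noteq> 0}))"
  have "\<forall>i j. M < i + j \<longrightarrow> coeff (coeff p j) i = 0"
  proof (intro allI impI, rule ccontr)
    fix i j assume *: "M < i + j" "coeff (coeff p j) i \<noteq> 0"
    have "i + j \<le> M" unfolding M_def
      by (rule Max_ge) (use finite_bipoly_support[of p] *(2) in \<open>auto simp: image_iff\<close>)
    with *(1) show False by simp
  qed
  hence "\<forall>i j. total_degree p < i + j \<longrightarrow> coeff (coeff p j) i = 0"
    unfolding total_degree_def by (rule LeastI)
  thus "total_degree p \<le> d \<Longrightarrow> \<forall>i j. d < i + j \<longrightarrow> coeff (coeff p j) i = 0"
    by auto
qed (simp add: total_degree_def Least_le)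

lemma coeff_family_in_coeff_space_iff:
  "(coeff_family P, coeff_family Q) \<in> coeff_space d \<longleftrightarrow> total_degree P \<le> d \<and> total_degree Q \<le> d"
  by (force simp: coeff_space_def total_degree_le_iff in_keys_iff lookup_coeff_family subset_iff
      not_le[symmetric])

lemma lookup_scaleR_poly_mapping:
  "Poly_Mapping.lookup (c *\<^sub>R a) k = c *\<^sub>R Poly_Mapping.lookup (a :: 'a \<Rightarrow>\<^sub>0 real) k"
  unfolding scaleR_poly_mapping_def
  by (subst lookup_Abs_poly_mapping) (auto intro: finite_subset[OF _ finite_lookup[of a]])

lemma subspace_coeff_space: "subspace (coeff_space d)"
proof -
  have *: "coeff_space d = {(a, b). \<forall>k. k \<notin> {(i, j). i + j \<le> d} \<longrightarrow>
      Poly_Mapping.lookup a k = 0 \<and> Poly_Mapping.lookup b k = 0}"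
    by (auto simp: coeff_space_def in_keys_iff)
  show ?thesis
    unfolding * subspace_def
    by (auto simp: lookup_add lookup_scaleR_poly_mapping zero_prod_def)
qed

lemma module_scale_bipoly: "module scale_bipoly"
  by unfold_locales
    (simp_all add: scale_bipoly_def smult_add_right mult.commute flip: smult_add_left one_pCons)

lemma partial_x_simps:
  "partial_x (p + q) = partial_x p + partial_x q"
  "partial_x (scale_bipoly c p) = scale_bipoly c (partial_x p)"
  "partial_x (p * q) = partial_x p * q + p * partial_x q"
proof -
  have sum: "pderiv (\<Sum>i\<in>I. h i) = (\<Sum>i\<in>I. pderiv (h i))" for I and h :: "nat \<Rightarrow> real poly"
    by (induction I rule: infinite_finite_induct) (simp_all add: pderiv_add)
  show "partial_x (p * q) = partial_x p * q + p * partial_x q"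
    by (rule poly_eqI)
       (simp add: partial_x_def coeff_map_poly coeff_mult sum pderiv_mult sum.distrib
         mult.commute[of "pderiv _"])
qed (rule poly_eqI; simp add: partial_x_def scale_bipoly_def coeff_map_poly pderiv_add pderiv_smult)+

lemma partial_y_simps:
  "partial_y (p + q) = partial_y p + partial_y q"
  "partial_y (scale_bipoly c p) = scale_bipoly c (partial_y p)"
  "partial_y (p * q) = partial_y p * q + p * partial_y q"
  by (simp_all add: partial_y_def scale_bipoly_def pderiv_add pderiv_smult pderiv_mult)

lemma partial_vars:
  "partial_x varX = 1" "partial_x varY = 0" "partial_y varX = 0" "partial_y varY = 1"
  by (simp_all add: partial_x_def partial_y_def varX_def varY_def map_poly_pCons pderiv_pCons
      one_pCons)

lemma is_derivation_vector_field: "is_derivation (vector_field P Q)"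
  unfolding is_derivation_def module_hom_def module_hom_axioms_def vector_field_def
  using module_scale_bipoly
  by (simp add: partial_x_simps partial_y_simps algebra_simps)
     (simp add: scale_bipoly_def smult_add_right)

lemma is_derivation_imp_vector_field:
  assumes "is_derivation \<delta>"
  shows "\<delta> = vector_field (\<delta> varX) (\<delta> varY)"
proof
  fix f
  define \<psi> where "\<psi> = vector_field (\<delta> varX) (\<delta> varY)"
  have D: "is_derivation \<psi>" unfolding \<psi>_def by (rule is_derivation_vector_field)
  have add: "\<phi> (p + q) = \<phi> p + \<phi> q" and scale: "\<phi> (smult [:c:] p) = smult [:c:] (\<phi> p)"
    and mult: "\<phi> (p * q) = \<phi> p * q + p * \<phi> q" if "is_derivation \<phi>" for \<phi> p q c
    using that
    by (auto simp: is_derivation_def module_hom_def module_hom_axioms_def scale_bipoly_def)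
  have zero: "\<phi> 0 = 0" if "is_derivation \<phi>" for \<phi>
    using add[OF that, of 0 0] by simp
  have one: "\<phi> 1 = 0" if "is_derivation \<phi>" for \<phi>
    using mult[OF that, of 1 1] by simp
  have const: "\<phi> [:[:c:]:] = 0" if "is_derivation \<phi>" for \<phi> c
    using scale[OF that, of c 1] one[OF that] by (simp add: one_pCons)
  have X: "\<delta> varX = \<psi> varX" and Y: "\<delta> varY = \<psi> varY"
    by (simp_all add: \<psi>_def vector_field_def partial_vars)
  have C: "\<delta> [:p:] = \<psi> [:p:]" for p
  proof (induction p)
    case 0
    show ?case using zero[OF assms] zero[OF D] by simp
  next
    case (pCons a p)
    have "[:pCons a p:] = [:[:a:]:] + varX * [:p:]" by (simp add: varX_def)
    thus ?case
      using pCons.IH X by (simp only: add[OF assms] add[OF D] mult[OF assms] mult[OF D]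
        const[OF assms] const[OF D])
  qed
  have "\<delta> f = \<psi> f"
  proof (induction f)
    case 0
    show ?case using zero[OF assms] zero[OF D] by simp
  next
    case (pCons a p)
    have "pCons a p = [:a:] + varY * p" by (simp add: varY_def)
    thus ?case
      using pCons.IH Y C by (simp only: add[OF assms] add[OF D] mult[OF assms] mult[OF D])
  qed
  thus "\<delta> f = vector_field (\<delta> varX) (\<delta> varY) f" by (simp add: \<psi>_def)
qed

lemma vf_coeffs_vector_field: "vf_coeffs (vector_field P Q) = (coeff_family P, coeff_family Q)"
  by (simp add: vf_coeffs_def vector_field_def partial_vars)

lemma inj_on_vf_coeffs: "inj_on vf_coeffs {\<delta>. is_derivation \<delta>}"
proof (rule inj_onI; clarify)
  fix \<delta> \<psi> assume "is_derivation \<delta>" "is_derivation \<psi>" "vf_coeffs \<delta> = vf_coeffs \<psi>"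
  thus "\<delta> = \<psi>"
    using is_derivation_imp_vector_field[of \<delta>] is_derivation_imp_vector_field[of \<psi>]
    by (simp add: vf_coeffs_def coeff_family_inject)
qed

lemma ex_defining_polys:
  assumes "line_arrangement \<A>"
  shows "\<exists>\<alpha>. defining_polys \<A> \<alpha>"
proof -
  have "\<exists>p. total_degree p = 1 \<and> L = {z. eval_bipoly p z = 0}" if "L \<in> \<A>" for L
  proof -
    have L: "affine L" "aff_dim L = 1"
      using assms that by (auto simp: line_arrangement_def)
    obtain u c where u: "u \<noteq> 0" "L = {z. u \<bullet> z = c}"
      using L aff_dim_eq_hyperplane[of L] by (auto simp: hull_same)
    obtain a b where ab: "u = (a, b)" by (cases u)
    define p :: bipoly where "p = [:[:-c, a:], [:b:]:]"
    have "total_degree p \<le> 1"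
      by (auto simp: total_degree_le_iff p_def coeff_pCons split: nat.splits)
    moreover have "\<not> total_degree p \<le> 0"
    proof
      assume "total_degree p \<le> 0"
      hence "coeff (coeff p 0) 1 = 0" "coeff (coeff p 1) 0 = 0"
        by (simp_all only: total_degree_le_iff)
      thus False using u(1) ab by (simp add: p_def zero_prod_def)
    qed
    ultimately have "total_degree p = 1" by linarith
    moreover have "L = {z. eval_bipoly p z = 0}"
      using u(2) ab by (auto simp: p_def eval_bipoly_def inner_prod_def algebra_simps)
    ultimately show ?thesis by blast
  qed
  thus ?thesis unfolding defining_polys_def by metis
qed

end

theory Submission
  imports Defs
begin

text \<open>For a fixed polynomial \<open>f\<close>, the value of a vector field at \<open>f\<close>
  depends linearly on its two components, so the fields sending \<open>f\<close> into the ideal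
  generated by \<open>f\<close> form a real vector space (\<open>subspace_coeffs_dvd\<close>). The
  degree bound only says that the coefficients lie in \<open>coeff_space d\<close>, which is a
  subspace too. With \<open>f\<close> the product of the linear forms, the image in question is the
  intersection of these two subspaces (\<open>vf_coeffs_filtered_derivations\<close>).\<close>

lemma coeff_family_linear:
  "coeff_family 0 = 0"
  "coeff_family (p + q) = coeff_family p + coeff_family q"
  "coeff_family (scale_bipoly c p) = c *\<^sub>R coeff_family p"
  by (rule poly_mapping_eqI;
      clarsimp simp: lookup_coeff_family lookup_add lookup_scaleR_poly_mapping scale_bipoly_def)+

text \<open>Linearity here is in the components, with the argument \<open>f\<close> held fixed; it
  is not the linearity of a derivation in its argument.\<close>

lemma vector_field_linear:
  "vector_field 0 0 f = 0"
  "vector_field (P + P') (Q + Q') f = vector_field P Q f + vector_field P' Q' f"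
  "vector_field (scale_bipoly c P) (scale_bipoly c Q) f = scale_bipoly c (vector_field P Q f)"
  by (simp_all add: vector_field_def scale_bipoly_def algebra_simps smult_add_right)

text \<open>The multiples of \<open>f\<close> are closed under sums and real scaling, and this pulls
  back along a linear map. No degree bound is imposed yet.\<close>

lemma subspace_coeffs_dvd:
  "subspace {(coeff_family P, coeff_family Q) |P Q. f dvd vector_field P Q f}"
    (is "subspace ?S")
  unfolding subspace_def
proof (intro conjI ballI allI)
  have "f dvd vector_field 0 0 f"
    by (simp add: vector_field_linear)
  then have "(coeff_family 0, coeff_family 0) \<in> ?S"
    by blast
  then show "0 \<in> ?S"
    by (simp add: coeff_family_linear zero_prod_def)
next
  fix u v assume "u \<in> ?S" "v \<in> ?S"
  then obtain P Q P' Q' where *: "u = (coeff_family P, coeff_family Q)"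
      "v = (coeff_family P', coeff_family Q')"
    and "f dvd vector_field P Q f" "f dvd vector_field P' Q' f"
    by blast
  then have "f dvd vector_field (P + P') (Q + Q') f"
    by (simp add: vector_field_linear)
  then have "(coeff_family (P + P'), coeff_family (Q + Q')) \<in> ?S"
    by blast
  then show "u + v \<in> ?S"
    by (simp add: * coeff_family_linear)
next
  fix c u assume "u \<in> ?S"
  then obtain P Q where *: "u = (coeff_family P, coeff_family Q)" and "f dvd vector_field P Q f"
    by blast
  then have "f dvd vector_field (scale_bipoly c P) (scale_bipoly c Q) f"
    \<comment> \<open>Linearity is stated for \<open>scale_bipoly\<close>, so that is unfolded to
      \<open>smult\<close> only afterwards.\<close>
    by (simp add: vector_field_linear) (simp add: scale_bipoly_def dvd_smult)
  then have "(coeff_family (scale_bipoly c P), coeff_family (scale_bipoly c Q)) \<in> ?S"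
    by blast
  then show "c *\<^sub>R u \<in> ?S"
    by (simp add: * coeff_family_linear)
qed

text \<open>Every \<open>vector_field P Q\<close> is a derivation, so only divisibility and the
  degree bound remain as conditions, and they separate.\<close>

lemma vf_coeffs_filtered_derivations:
  fixes \<alpha> \<A>
  defines "f \<equiv> arrangement_poly \<alpha> \<A>"
  shows "vf_coeffs ` filtered_derivations \<alpha> \<A> d =
    coeff_space d \<inter> {(coeff_family P, coeff_family Q) |P Q. f dvd vector_field P Q f}"
proof -
  have "filtered_derivations \<alpha> \<A> d = {vector_field P Q |P Q. f dvd vector_field P Q f \<and>
      (coeff_family P, coeff_family Q) \<in> coeff_space d}"
    by (simp add: filtered_derivations_def arr_derivations_def is_derivation_vector_field
        coeff_family_in_coeff_space_iff f_def)
  then show ?thesis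
    \<comment> \<open>For the inclusion from right to left, the preimage of a pair of families is
      \<open>vector_field P Q\<close> itself.\<close>
    by (auto simp: vf_coeffs_vector_field coeff_family_inject
        intro!: image_eqI[where f = vf_coeffs, OF vf_coeffs_vector_field[symmetric]])
qed

theorem theorem2p5:
  fixes \<A> :: "(real \<times> real) set set"
    and \<alpha> :: "(real \<times> real) set \<Rightarrow> bipoly"
    and d :: nat
  assumes "line_arrangement \<A>"
    and "defining_polys \<A> \<alpha>"
  shows "vf_coeffs ` filtered_derivations \<alpha> \<A> d \<subseteq> coeff_space d \<and>
         subspace (vf_coeffs ` filtered_derivations \<alpha> \<A> d)"
  unfolding vf_coeffs_filtered_derivations
  by (simp add: subspace_inter subspace_coeff_space subspace_coeffs_dvd)

end
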